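(* With the ring $R$ and the ideal $K_l(n,d)$ as defined below, the element $s_n - f_n$ of $R$ lies in $K_l(n,d)$ and has degree $1$, but when it is written as an $R$-linear combination of the listed generators of $K_l(n,d)$, the degree of at least one coefficient is doubly exponential in $n$. In other words, the family $K_l(n,d)$ satisfies the doubly exponential ideal membership property.
   Context: Let $n, d \ge 2$ be integers and $k$ a field. Let $$R = k[s_2, \ldots, s_n, f_2, \ldots, f_n, b_{0i}, \ldots, b_{n-1,i}, c_{1i}, \ldots, c_{n-1,i} \mid i = 1, \ldots, 4],$$ a polynomial ring of dimension $10n-6$ in these variables. The ideal $K_l(n,d)\subseteq R$ is generated by the following elements: $G_{01} = b_{01} b_{03}^d - b_{04} b_{02}^d$; $G_{1i} = c_{1i}(b_{02}-b_{1i} b_{03})$ and $G_{1,4+i} = c_{1i}(b_{01}-b_{1i}^d b_{04})$ for $i = 1, \ldots, 4$; $G_{1ij} = c_{1i} c_{1j}(b_{1i} - b_{1j})$ for $1 \le i < j \le 4$; $G_{21} = b_{04}^d c_{11} - b_{01}^d c_{12}$, $G_{22} = b_{04}^d c_{14} - b_{01}^d c_{13}$, $G_{23} = b_{01}^d (c_{12} -c_{13})$, $G_{24} = b_{04}^d (c_{12} b_{11} -c_{13} b_{14})$; $G_{2,4+i} = b_{04}^d c_{12} c_{2i}(b_{12}-b_{2i} b_{13})$ for $i = 1, \ldots, 4$; $G_{20} = s_2 - c_{11}$, $G_{2,-1} = f_2 - c_{14}$; for $r = 3, \ldots, n-1$: $G_{r0} = s_r - s_{r-1} c_{r-1,1}$,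 $G_{r,-1} = f_r - s_{r-1} c_{r-1,4}$; for $r = 3, \ldots, n$: $G_{r1} = b_{01}^d(f_{r-1} c_{r-1,1} - s_{r-1} c_{r-1,2})$, $G_{r2} = b_{01}^d(f_{r-1} c_{r-1,4} - s_{r-1} c_{r-1,3})$, $G_{r3} = b_{01}^d s_{r-1}(c_{r-1,3} - c_{r-1,2})$, $G_{r4} = b_{01}^d f_{r-1}(c_{r-1,2} b_{r-1,1} - c_{r-1,3} b_{r-1,4})$; for $r = 3, \ldots, n-1$ and $i=1,\ldots,4$: $G_{r,4+i} = b_{01}^d f_{r-1} c_{r-1,2} c_{ri}(b_{r-1,2} - b_{ri} b_{r-1,3})$; $G_{n0} = s_n - s_{n-1} c_{n-1,1} b_{01}^d$, $G_{n,-1} = f_n - s_{n-1} c_{n-1,4} b_{01}^d$, $G_{n5} = b_{01}^d f_{n-1} c_{n-1,2}(b_{n-1,2} - b_{n-1,3})$. The maximal degree of a generator of $K_l(n,d)$ is $d+5$.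
   Formalization: Stated for n ≥ 3 instead of n ≥ 2: for n = 2 the listed generators G_{2,4+i} and G_{n0}, G_{n,-1} involve c_{2i}, b_{2i} and s_1, which are not variables of R, so K_l(2,d) is not defined. *)

theory Defs
  imports Complex_Main "HOL-Library.Poly_Mapping"
begin

datatype var = S nat | F nat | B nat nat | C nat nat

type_synonym 'k mpoly = "(var \<Rightarrow>\<^sub>0 nat) \<Rightarrow>\<^sub>0 'k"

definition Var :: "var \<Rightarrow> 'k::comm_ring_1 mpoly" where
  "Var v = Poly_Mapping.single (Poly_Mapping.single v 1) 1"

text \<open>Total degree (the zero polynomial gets degree 0).\<close>
definition tdeg :: "'k::zero mpoly \<Rightarrow> nat" where
  "tdeg p = Max (insert 0 ((\<lambda>m. \<Sum>v\<in>Poly_Mapping.keys m. Poly_Mapping.lookup m v) ` Poly_Mapping.keys p))"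

definition varsR :: "nat \<Rightarrow> var set" where
  "varsR n = {S r | r. 2 \<le> r \<and> r \<le> n} \<union> {F r | r. 2 \<le> r \<and> r \<le> n}
           \<union> {B j i | j i. j \<le> n - 1 \<and> 1 \<le> i \<and> i \<le> 4}
           \<union> {C j i | j i. 1 \<le> j \<and> j \<le> n - 1 \<and> 1 \<le> i \<and> i \<le> 4}"

definition Rn :: "nat \<Rightarrow> 'k::zero mpoly set" where
  "Rn n = {p. \<forall>m\<in>Poly_Mapping.keys p. Poly_Mapping.keys m \<subseteq> varsR n}"

text \<open>The listed generators of K_l(n,d) (for n \<ge> 3), in the order of the paper.\<close>
definition Kgens :: "nat \<Rightarrow> nat \<Rightarrow> 'k::comm_ring_1 mpoly list" where
  "Kgens n d = (let s = (\<lambda>r. Var (S r)); f = (\<lambda>r. Var (F r));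
                    b = (\<lambda>j i. Var (B j i)); c = (\<lambda>j i. Var (C j i)) in
     [b 0 1 * b 0 3 ^ d - b 0 4 * b 0 2 ^ d]
   @ [c 1 i * (b 0 2 - b 1 i * b 0 3). i \<leftarrow> [1..<5]]
   @ [c 1 i * (b 0 1 - b 1 i ^ d * b 0 4). i \<leftarrow> [1..<5]]
   @ [c 1 i * c 1 j * (b 1 i - b 1 j). i \<leftarrow> [1..<5], j \<leftarrow> [1..<5], i < j]
   @ [b 0 4 ^ d * c 1 1 - b 0 1 ^ d * c 1 2,
      b 0 4 ^ d * c 1 4 - b 0 1 ^ d * c 1 3,
      b 0 1 ^ d * (c 1 2 - c 1 3),
      b 0 4 ^ d * (c 1 2 * b 1 1 - c 1 3 * b 1 4)]
   @ [b 0 4 ^ d * c 1 2 * c 2 i * (b 1 2 - b 2 i * b 1 3). i \<leftarrow> [1..<5]]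
   @ [s 2 - c 1 1, f 2 - c 1 4]
   @ concat [[s r - s (r - 1) * c (r - 1) 1, f r - s (r - 1) * c (r - 1) 4]. r \<leftarrow> [3..<n]]
   @ concat [[b 0 1 ^ d * (f (r - 1) * c (r - 1) 1 - s (r - 1) * c (r - 1) 2),
              b 0 1 ^ d * (f (r - 1) * c (r - 1) 4 - s (r - 1) * c (r - 1) 3),
              b 0 1 ^ d * s (r - 1) * (c (r - 1) 3 - c (r - 1) 2),
              b 0 1 ^ d * f (r - 1) * (c (r - 1) 2 * b (r - 1) 1 - c (r - 1) 3 * b (r - 1) 4)].
             r \<leftarrow> [3..<n+1]]
   @ [b 0 1 ^ d * f (r - 1) * c (r - 1) 2 * c r i * (b (r - 1) 2 - b r i * b (r - 1) 3).
        r \<leftarrow> [3..<n], i \<leftarrow> [1..<5]]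
   @ [s n - s (n - 1) * c (n - 1) 1 * b 0 1 ^ d,
      f n - s (n - 1) * c (n - 1) 4 * b 0 1 ^ d,
      b 0 1 ^ d * f (n - 1) * c (n - 1) 2 * (b (n - 1) 2 - b (n - 1) 3)])"

definition is_Krep :: "nat \<Rightarrow> nat \<Rightarrow> 'k::comm_ring_1 mpoly list \<Rightarrow> 'k mpoly \<Rightarrow> bool" where
  "is_Krep n d q p \<longleftrightarrow> length q = length (Kgens n d :: 'k mpoly list) \<and> set q \<subseteq> Rn n
      \<and> sum_list (map2 (*) q (Kgens n d)) = p"

definition in_K :: "nat \<Rightarrow> nat \<Rightarrow> 'k::comm_ring_1 mpoly \<Rightarrow> bool" where
  "in_K n d p \<longleftrightarrow> (\<exists>q. is_Krep n d q p)"

end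

theory Submission
  imports Defs "HOL-Library.Function_Algebras"
begin

text \<open>
  All generators are differences of two monomials. Hence a representation of $s_n - f_n$ whose
  coefficients have small degree yields a chain of monomials from $s_n$ to $f_n$ in which each step
  multiplies both monomials of a generator by a monomial of small degree; equivalently, a set of
  monomials that is closed under these steps and contains $s_n$ must contain $f_n$.

  Write $S_1 = b_{01}^d$, $F_1 = b_{04}^d$ and $S_r = b_{01}^d s_r$, $F_r = b_{01}^d f_r$ for
  $r \ge 2$. Modulo the ideal, $S_r c_{ri} = F_r c_{ri} b_{ri}^{e_r}$ with $e_r = d^{2^r}$: level
  $r + 1$ runs through a loop that exchanges one factor $b_{r1}$ for one $b_{r4}$ and gains
  $b_{r+1,i}^{e_r}$, and it must do so $e_r$ times. At the top level no $b_n$ is left to collect,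
  whence $s_n = f_n$.

  Conversely, the monomials reachable from $S_r$ can be described explicitly, level by level. A chain
  from $s_n$ can only replace its factor $c_{n-1,1}$ at a monomial that contains
  $F_{n-1} c_{n-1,1} b_{n-1,1}^{e_{n-1}}$. The step is then a multiple of the generator
  $b_{01}^d (f_{n-1} c_{n-1,1} - s_{n-1} c_{n-1,2})$ by a monomial of degree at least $e_{n-1}$.
\<close>

section \<open>Monomials reachable from the start\<close>

text \<open>Exponent vectors are plain functions, so that products of monomials are pointwise sums
  which simplification evaluates.\<close>

definition unit_exp :: "var \<Rightarrow> nat \<Rightarrow> var \<Rightarrow> nat" where
  "unit_exp v k = (\<lambda>w. if w = v then k else 0)"

definition counter_bound :: "nat \<Rightarrow> nat \<Rightarrow> nat" where
  "counter_bound d r = d ^ 2 ^ Suc r"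

text \<open>
  Describes level $r$ of a reachable monomial by the exponents \<open>c\<close>, \<open>b\<close> of the variables $c_{ri}$, $b_{ri}$,
  where \<open>e\<close> is $e_r$, \<open>k\<close> counts completed loops (it is an integer as dead ends leave the range
  $0, \ldots, e$), \<open>y\<close> is the number of factors $b_{ri}$ that the lower levels have produced for the current
  $c_{ri}$, and \<open>x\<close> the number of factors that level $r$ has produced for the level above.
\<close>
definition level_inv :: "nat \<Rightarrow> (nat \<Rightarrow> nat) \<Rightarrow> (nat \<Rightarrow> nat) \<Rightarrow> int \<Rightarrow> int \<Rightarrow> int \<Rightarrow> bool" where
  "level_inv e c b k y x \<longleftrightarrow>
     c 1 = 1 \<and> c 2 = 0 \<and> c 3 = 0 \<and> c 4 = 0 \<and>
       int (b 1) = y - k \<and> int (b 4) = k \<and> b 2 = 0 \<and> b 3 = 0 \<and> x = k * int e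
   \<or> c 1 = 0 \<and> c 2 = 1 \<and> c 3 = 0 \<and> c 4 = 0 \<and>
       int (b 1) = int e - k \<and> int (b 4) = k \<and> int (b 2) + int (b 3) = y \<and> x = k * int e + int (b 3)
   \<or> c 1 = 0 \<and> c 2 = 0 \<and> c 3 = 1 \<and> c 4 = 0 \<and>
       int (b 1) = int e - k \<and> int (b 4) = k \<and> int (b 2) + int (b 3) = y \<and> x = k * int e - int (b 2)
   \<or> c 1 = 0 \<and> c 2 = 0 \<and> c 3 = 0 \<and> c 4 = 1 \<and>
       int (b 1) = int e - k \<and> int (b 4) = k - int e + y \<and> b 2 = 0 \<and> b 3 = 0 \<and> x = k * int e"

text \<open>
  Levels are shifted by one: \<open>reach d r\<close>, \<open>start_exp d r\<close>, \<open>finish_exp d r\<close>, \<open>counter_bound d r\<close>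
  belong to $S_{r+1}$, $F_{r+1}$ and $e_{r+1}$. The variables $s_r$, $f_r$ do not occur: they are
  replaced by products of variables $c_{ji}$, as the generators $G_{r0}$ and $G_{r,-1}$ permit.
\<close>
primrec reach :: "nat \<Rightarrow> nat \<Rightarrow> (var \<Rightarrow> nat) \<Rightarrow> int \<Rightarrow> bool" where
  "reach d 0 h x \<longleftrightarrow> h (B 0 1) + h (B 0 4) = d \<and> h (B 0 2) = 0 \<and> h (B 0 3) = 0
     \<and> x = int d * int (h (B 0 4))"
| "reach d (Suc r) h x \<longleftrightarrow> (\<exists>k y. reach d r h y \<and>
     level_inv (counter_bound d r) (\<lambda>i. h (C (Suc r) i)) (\<lambda>i. h (B (Suc r) i)) k y x)"

primrec start_exp :: "nat \<Rightarrow> nat \<Rightarrow> var \<Rightarrow> nat" where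
  "start_exp d 0 = unit_exp (B 0 1) d"
| "start_exp d (Suc r) = start_exp d r + unit_exp (C (Suc r) 1) 1"

primrec finish_exp :: "nat \<Rightarrow> nat \<Rightarrow> var \<Rightarrow> nat" where
  "finish_exp d 0 = unit_exp (B 0 4) d"
| "finish_exp d (Suc r) = start_exp d r + unit_exp (C (Suc r) 4) 1"

text \<open>The condition that a cofactor brings in no further variable of the levels up to
  \<open>r\<close>.\<close>

primrec vanishes :: "nat \<Rightarrow> (var \<Rightarrow> nat) \<Rightarrow> bool" where
  "vanishes 0 h \<longleftrightarrow> (\<forall>i\<in>{1,2,3,4}. h (B 0 i) = 0)"
| "vanishes (Suc r) h \<longleftrightarrow> vanishes r h \<and> (\<forall>i\<in>{1,2,3,4}. h (B (Suc r) i) = 0 \<and> h (C (Suc r) i) = 0)"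

lemma unit_exp_simps [simp]:
  "unit_exp (B j i) k (C j' i') = 0"
  "unit_exp (C j i) k (B j' i') = 0"
  "unit_exp (C j i) k (C j' i') = (if j' = j \<and> i' = i then k else 0)"
  "unit_exp (B j i) k (B j' i') = (if j' = j \<and> i' = i then k else 0)"
  by (auto simp: unit_exp_def)

lemma start_exp_C [simp]: "r < t \<Longrightarrow> start_exp d r (C t i) = 0"
  by (induction r) auto

lemma start_exp_B [simp]: "0 < t \<Longrightarrow> start_exp d r (B t i) = 0"
  by (induction r) auto

lemma finish_exp_C [simp]: "r < t \<Longrightarrow> finish_exp d r (C t i) = 0"
  by (cases r) auto

lemma finish_exp_B [simp]: "0 < t \<Longrightarrow> finish_exp d r (B t i) = 0"
  by (cases r) auto

lemma reach_cong:
  assumes "\<And>t i. t \<le> r \<Longrightarrow> h (B t i) = h' (B t i) \<and> h (C t i) = h' (C t i)"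
  shows "reach d r h x = reach d r h' x"
  using assms by (induction r arbitrary: x) auto

lemma reach_add_unit [simp]:
  assumes "r < t"
  shows "reach d r (h + unit_exp (C t i) k) x = reach d r h x"
    and "reach d r (h + unit_exp (B t i) k) x = reach d r h x"
  by (rule reach_cong; use assms in auto)+

lemma vanishes_add_unit [simp]:
  assumes "r < t"
  shows "vanishes r (h + unit_exp (C t i) k) = vanishes r h"
    and "vanishes r (h + unit_exp (B t i) k) = vanishes r h"
  using assms by (induction r) auto

lemma counter_bound_0: "counter_bound d 0 = d * d"
  by (simp add: counter_bound_def power2_eq_square)

lemma counter_bound_Suc: "counter_bound d (Suc r) = counter_bound d r * counter_bound d r"
  by (simp add: counter_bound_def flip: power_add)

text \<open>Nonnegative exponents pin down the integer \<open>k\<close>. Over the start of the level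
  below, \<open>y = 0\<close>: in state $c_1$ the exponents of $b_1$, $b_4$ are $-k$ and $k$, so $k
  = 0$; in state $c_4$ they are $e - k$ and $k - e$, so $k = e$ and $x = e^2$. This squaring makes
  the bound doubly exponential.\<close>

lemma reach_start_finish:
  "reach d r (h + start_exp d r) y \<longleftrightarrow> y = 0 \<and> vanishes r h"
  "reach d r (h + finish_exp d r) y \<longleftrightarrow> y = int (counter_bound d r) \<and> vanishes r h"
proof (induction r arbitrary: h y)
  case 0
  { case 1 then show ?case by auto }
  { case 2 then show ?case by (auto simp: counter_bound_0) }
next
  case (Suc r)
  { case 1
    show ?case
      unfolding start_exp.simps add.assoc[symmetric] reach.simps vanishes.simps
      by (auto simp: Suc level_inv_def) }
  { case 2
    show ?case
      unfolding finish_exp.simps add.assoc[symmetric] reach.simps vanishes.simps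
      by (auto simp: Suc level_inv_def counter_bound_Suc) }
qed

lemmas reach_start [simp] = reach_start_finish(1)
lemmas reach_finish [simp] = reach_start_finish(2)

text \<open>States $c_1$, $c_4$ over the finish of the level below (\<open>y = e\<close>) and states
  $c_2$, $c_3$ over its start (\<open>y = 0\<close>) impose the same conditions on the $b_i$, with
  the same \<open>k\<close> and \<open>x\<close>. This gives the first three moves.\<close>

lemma reach_move_1:
  "reach d (Suc r) (h + finish_exp d r + unit_exp (C (Suc r) 1) 1) x
     = reach d (Suc r) (h + start_exp d r + unit_exp (C (Suc r) 2) 1) x"
  by (auto simp: level_inv_def)

lemma reach_move_2:
  "reach d (Suc r) (h + finish_exp d r + unit_exp (C (Suc r) 4) 1) x
     = reach d (Suc r) (h + start_exp d r + unit_exp (C (Suc r) 3) 1) x"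
  by (auto simp: level_inv_def)

lemma reach_move_3:
  "reach d (Suc r) (h + start_exp d r + unit_exp (C (Suc r) 3) 1) x
     = reach d (Suc r) (h + start_exp d r + unit_exp (C (Suc r) 2) 1) x"
  by (auto simp: level_inv_def)

text \<open>A loop is completed: \<open>k\<close> on the left becomes \<open>k + 1\<close> on the
  right. Since $b_2 + b_3 = e$ on both sides, $ke + b_3 = (k+1)e - b_2$, so \<open>x\<close> is
  preserved.\<close>

lemma reach_move_4:
  "reach d (Suc r) (h + finish_exp d r + unit_exp (C (Suc r) 2) 1 + unit_exp (B (Suc r) 1) 1) x
     = reach d (Suc r) (h + finish_exp d r + unit_exp (C (Suc r) 3) 1 + unit_exp (B (Suc r) 4) 1) x"
    (is "?L = ?R")
proof
  assume ?L
  then show ?R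
    by (auto simp: level_inv_def distrib_left distrib_right)
next
  assume ?R
  then show ?L
    by (auto simp: level_inv_def distrib_left distrib_right)
qed

lemma reach_move_5:
  "reach d (Suc r) (h + finish_exp d r + unit_exp (C (Suc r) 2) 1 + unit_exp (B (Suc r) 2) 1) x
     = reach d (Suc r) (h + finish_exp d r + unit_exp (C (Suc r) 2) 1 + unit_exp (B (Suc r) 3) 1) (x + 1)"
  by (auto simp: level_inv_def distrib_left distrib_right)

text \<open>The factor $c_{r+1,i}$ forces state $i$, in which \<open>level_inv\<close> depends on
  \<open>y\<close> and the exponent of $b_{r+1,i}$ only through their difference. Raising both by
  \<open>\<delta>\<close> thus preserves \<open>k\<close> and \<open>x\<close>.\<close>

lemma reach_shift:
  assumes "\<And>y. reach d r h y = reach d r h' (y + int \<delta>)"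
    and "\<And>i. h (B (Suc r) i) = h' (B (Suc r) i) \<and> h (C (Suc r) i) = h' (C (Suc r) i)"
    and "i \<in> {1,2,3,4}"
  shows "reach d (Suc r) (h + unit_exp (C (Suc r) i) 1) x
     = reach d (Suc r) (h' + unit_exp (C (Suc r) i) 1 + unit_exp (B (Suc r) i) \<delta>) x"
proof -
  have shift: "level_inv e (\<lambda>j. (h + unit_exp (C (Suc r) i) 1) (C (Suc r) j))
           (\<lambda>j. (h + unit_exp (C (Suc r) i) 1) (B (Suc r) j)) k y x =
     level_inv e (\<lambda>j. (h' + unit_exp (C (Suc r) i) 1 + unit_exp (B (Suc r) i) \<delta>) (C (Suc r) j))
           (\<lambda>j. (h' + unit_exp (C (Suc r) i) 1 + unit_exp (B (Suc r) i) \<delta>) (B (Suc r) j))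
           k (y + int \<delta>) x" for e k y
    using assms(3) by (auto simp: assms(2) level_inv_def)
  \<comment> \<open>The shift is a bijection because \<open>y\<close> ranges over the
    integers.\<close>
  have "(\<exists>y. reach d r h' y \<and> Q y) \<longleftrightarrow> (\<exists>y. reach d r h' (y + int \<delta>) \<and> Q (y + int \<delta>))" for Q
    by (metis diff_add_cancel)
  then show ?thesis
    unfolding reach.simps shift by (simp only: reach_add_unit lessI assms(1))
qed

text \<open>Higher levels see the levels up to \<open>r\<close> only through the value
  \<open>y\<close>.\<close>

lemma reach_lift:
  assumes "r \<le> r'" and "\<And>y. reach d r h y = reach d r h' y"
    and "\<And>t i. r < t \<Longrightarrow> h (B t i) = h' (B t i) \<and> h (C t i) = h' (C t i)"
  shows "reach d r' h x = reach d r' h' x"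
  using assms(1) by (induction arbitrary: x rule: dec_induct) (auto simp: assms(2,3))

lemma vanishes_zero: "vanishes r 0"
  by (induction r) auto

section \<open>A set of monomials left only in large degree\<close>

text \<open>For level \<open>N\<close> in state $c_{N1}$, the value \<open>x = 0\<close> forces the loop counter to be \<open>0\<close>.\<close>
definition trap :: "nat \<Rightarrow> nat \<Rightarrow> (var \<Rightarrow> nat) \<Rightarrow> bool" where
  "trap d N h \<longleftrightarrow> reach d N h 0 \<and> h (C N 1) = 1"

text \<open>The bound on the cofactor \<open>h\<close>, which is $e_N$, is what makes
  \<open>trap_move_1\<close> hold at the top level, the one place where a chain could leave the
  trap.\<close>

definition trap_move :: "nat \<Rightarrow> nat \<Rightarrow> (var \<Rightarrow> nat) \<Rightarrow> (var \<Rightarrow> nat) \<Rightarrow> bool" where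
  "trap_move d N a b \<longleftrightarrow>
     (\<forall>h. h (B N 1) < d ^ 2 ^ N \<longrightarrow> trap d N (h + a) = trap d N (h + b))"

lemma trap_moveI:
  assumes "r \<le> N" and "\<And>h y. reach d r (h + a) y = reach d r (h + b) y"
    and "\<And>t i. r < t \<Longrightarrow> a (B t i) = b (B t i) \<and> a (C t i) = b (C t i)"
    and "a (C N 1) = b (C N 1)"
  shows "trap_move d N a b"
proof -
  have "reach d N (h + a) 0 = reach d N (h + b) 0" for h
    by (rule reach_lift[OF assms(1,2)]) (simp add: assms(3))
  then show ?thesis
    using assms(4) by (simp add: trap_move_def trap_def)
qed

lemma trap_move_refl [simp]: "trap_move d N a a"
  by (simp add: trap_move_def)

lemma trap_exactly_one:
  assumes "trap d (Suc N) h"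
  shows "h (C (Suc N) 2) = 0" "h (C (Suc N) 3) = 0" "h (C (Suc N) 4) = 0"
  using assms by (auto simp: trap_def level_inv_def)

text \<open>Meant for the generator that exchanges $b_{N2}$ and $b_{N3}$. It changes
  \<open>x\<close> with no higher level to compensate, but both of its monomials contain $c_{N2}$
  and so lie outside the trap.\<close>

lemma trap_move_outside:
  assumes "i \<in> {2,3,4}" "j \<in> {2,3,4}" "0 < a (C N i)" "0 < b (C N j)" "0 < N"
  shows "trap_move d N a b"
proof -
  obtain M where "N = Suc M" using \<open>0 < N\<close> by (cases N) auto
  then have "\<not> trap d N (h + a)" "\<not> trap d N (h + b)" for h
    using trap_exactly_one[of d M "h + a"] trap_exactly_one[of d M "h + b"] assms by auto
  then show ?thesis by (simp add: trap_move_def)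
qed

lemma trap_reach_0:
  assumes "trap d N h"
  shows "h (B 0 2) = 0" "h (B 0 3) = 0"
proof -
  have "reach d N h x \<Longrightarrow> h (B 0 2) = 0 \<and> h (B 0 3) = 0" for x
    by (induction N arbitrary: x) auto
  then show "h (B 0 2) = 0" "h (B 0 3) = 0"
    using assms by (auto simp: trap_def)
qed

text \<open>No reachable monomial contains $b_{02}$ or $b_{03}$, so both sides lie outside the
  trap.\<close>

lemma trap_move_B02_B03:
  assumes "i \<in> {2,3}" "j \<in> {2,3}" "0 < a (B 0 i)" "0 < b (B 0 j)"
  shows "trap_move d N a b"
proof -
  have "\<not> trap d N (h + a)" "\<not> trap d N (h + b)" for h
    using trap_reach_0[of d N "h + a"] trap_reach_0[of d N "h + b"] assms by auto
  then show ?thesis by (simp add: trap_move_def)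
qed

lemma trap_move_1:
  assumes "r < N"
  shows "trap_move d N (finish_exp d r + unit_exp (C (Suc r) 1) 1)
                       (start_exp d r + unit_exp (C (Suc r) 2) 1)"
proof (cases "Suc r = N")
  case False
  with assms show ?thesis
    by (intro trap_moveI[of "Suc r"]) (auto simp only: add.assoc[symmetric] reach_move_1, auto)
next
  case True
  then have N: "N = Suc r" ..
  have False
    if h: "h (B (Suc r) 1) < d ^ 2 ^ Suc r"
      and tr: "trap d (Suc r) (h + finish_exp d r + unit_exp (C (Suc r) 1) 1)" for h
  proof -
    \<comment> \<open>The finish below gives \<open>y = e\<close>, and \<open>x = 0\<close> means
      $ke = 0$. For $d > 0$ this yields $k = 0$, so the exponent of $b_{N1}$ is $e$; for $d = 0$ the
      bound on \<open>h\<close> is already contradictory.\<close>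
    have "int (h (B (Suc r) 1)) = int (counter_bound d r)"
      using tr h by (cases "d = 0") (auto simp: trap_def level_inv_def counter_bound_def power_0_left)
    with h show False
      by (simp add: counter_bound_def)
  qed
  moreover have "\<not> trap d (Suc r) (h + start_exp d r + unit_exp (C (Suc r) 2) 1)" for h
    using trap_exactly_one[of d r "h + start_exp d r + unit_exp (C (Suc r) 2) 1"] by auto
  ultimately show ?thesis
    unfolding trap_move_def N add.assoc[symmetric] by blast
qed

lemma trap_move_2:
  assumes "r < N"
  shows "trap_move d N (finish_exp d r + unit_exp (C (Suc r) 4) 1)
                       (start_exp d r + unit_exp (C (Suc r) 3) 1)"
  using assms by (intro trap_moveI[of "Suc r"]) (auto simp only: add.assoc[symmetric] reach_move_2, auto)

lemma trap_move_3:
  assumes "r < N"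
  shows "trap_move d N (start_exp d r + unit_exp (C (Suc r) 3) 1)
                       (start_exp d r + unit_exp (C (Suc r) 2) 1)"
  using assms by (intro trap_moveI[of "Suc r"]) (auto simp only: add.assoc[symmetric] reach_move_3, auto)

lemma trap_move_4:
  assumes "r < N"
  shows "trap_move d N (finish_exp d r + unit_exp (C (Suc r) 2) 1 + unit_exp (B (Suc r) 1) 1)
                       (finish_exp d r + unit_exp (C (Suc r) 3) 1 + unit_exp (B (Suc r) 4) 1)"
  using assms by (intro trap_moveI[of "Suc r"]) (auto simp only: add.assoc[symmetric] reach_move_4, auto)

text \<open>By \<open>reach_move_5\<close> the exchange of $b_2$ for $b_3$ raises the output of its
  level by one; by \<open>reach_shift\<close> the new factor $b_i$ of the next level absorbs
  this.\<close>

lemma trap_move_5: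
  assumes "Suc r < N" "i \<in> {1,2,3,4}"
  shows "trap_move d N
     (finish_exp d r + unit_exp (C (Suc r) 2) 1 + unit_exp (C (Suc (Suc r)) i) 1 + unit_exp (B (Suc r) 2) 1)
     (finish_exp d r + unit_exp (C (Suc r) 2) 1 + unit_exp (C (Suc (Suc r)) i) 1
        + unit_exp (B (Suc (Suc r)) i) 1 + unit_exp (B (Suc r) 3) 1)"
proof -
  let ?h = "\<lambda>h j. h + finish_exp d r + unit_exp (C (Suc r) 2) 1 + unit_exp (B (Suc r) j) 1"
  have "reach d (Suc (Suc r)) (?h h 2 + unit_exp (C (Suc (Suc r)) i) 1) x
      = reach d (Suc (Suc r))
          (?h h 3 + unit_exp (C (Suc (Suc r)) i) 1 + unit_exp (B (Suc (Suc r)) i) 1) x" for h x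
    by (rule reach_shift) (use assms(2) in \<open>simp_all only: reach_move_5 of_nat_1, auto\<close>)
  then show ?thesis
    using assms(1) by (intro trap_moveI[of "Suc (Suc r)"]) (auto simp: ac_simps)
qed

text \<open>Replacing $b_{01}$ by $b_{04}$ raises the output of level 0 by \<open>d\<close>, which
  \<open>reach_shift\<close> balances with $b_{1i}^d$.\<close>

lemma trap_move_base:
  assumes "0 < N" "i \<in> {1,2,3,4}"
  shows "trap_move d N (unit_exp (C 1 i) 1 + unit_exp (B 0 1) 1)
                       (unit_exp (C 1 i) 1 + unit_exp (B 1 i) d + unit_exp (B 0 4) 1)"
proof -
  have "reach d (Suc 0) (h + unit_exp (B 0 1) 1 + unit_exp (C (Suc 0) i) 1) x
      = reach d (Suc 0)
          (h + unit_exp (B 0 4) 1 + unit_exp (C (Suc 0) i) 1 + unit_exp (B (Suc 0) i) d) x" for h x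
    by (rule reach_shift) (use assms(2) in \<open>auto simp: algebra_simps\<close>)
  then show ?thesis
    using assms(1) by (intro trap_moveI[of "Suc 0"]) (auto simp: ac_simps)
qed

text \<open>A reachable monomial contains exactly one $c_{1i}$, so a product of two different ones
  is outside the trap.\<close>

lemma trap_move_C1_C1:
  assumes "i \<noteq> j" "i \<in> {1,2,3,4}" "j \<in> {1,2,3,4}" "0 < N"
    "0 < a (C 1 i)" "0 < a (C 1 j)" "0 < b (C 1 i)" "0 < b (C 1 j)"
  shows "trap_move d N a b"
proof -
  have *: False if "reach d N h x" "0 < h (C 1 i)" "0 < h (C 1 j)" for h x
  proof -
    have "\<exists>x. reach d (Suc 0) h x"
      using \<open>0 < N\<close> that(1)
      by (induction N arbitrary: x) (auto, metis gr0I reach.simps(2) One_nat_def)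
    then show False using that(2,3) assms(1,2,3) by (auto simp: level_inv_def)
  qed
  have "\<not> trap d N (h + a)" "\<not> trap d N (h + b)" for h
    using *[of "h + a"] *[of "h + b"] assms by (auto simp: trap_def)
  then show ?thesis by (simp add: trap_move_def)
qed

lemma trap_start: "0 < N \<Longrightarrow> trap d N (start_exp d N)"
  using reach_start[of d N 0 0] by (cases N) (auto simp: trap_def vanishes_zero)

section \<open>Coefficient sums over a set of monomials\<close>

abbreviation monom :: "(var \<Rightarrow>\<^sub>0 nat) \<Rightarrow> 'k::comm_ring_1 mpoly" where
  "monom a \<equiv> Poly_Mapping.single a 1"

lemma monom_mult: "monom a * monom b = (monom (a + b) :: 'k::comm_ring_1 mpoly)"
  by (simp add: mult_single)

lemma monom_power: "monom (Poly_Mapping.single v 1) ^ k = (monom (Poly_Mapping.single v k) :: 'k::comm_ring_1 mpoly)"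
  by (induction k) (simp_all add: monom_mult flip: single_add)

lemma Var_eq_monom: "Var v = (monom (Poly_Mapping.single v 1) :: 'k::comm_ring_1 mpoly)"
  by (simp add: Var_def)

lemma sum_keys_superset:
  assumes "finite A" "Poly_Mapping.keys p \<subseteq> A" "\<And>x. f x 0 = 0"
  shows "(\<Sum>x\<in>Poly_Mapping.keys p. f x (Poly_Mapping.lookup p x)) = (\<Sum>x\<in>A. f x (Poly_Mapping.lookup p x))"
  using assms by (intro sum.mono_neutral_left) (auto simp: in_keys_iff)

text \<open>Kept general in \<open>f\<close>: it gives the additivity of both
  \<open>coeff_sum\<close> and \<open>subst_exp\<close>.\<close>

lemma sum_keys_add:
  fixes p q :: "'a \<Rightarrow>\<^sub>0 'b::monoid_add"
  assumes "\<And>x. f x 0 = 0" and "\<And>x a b. f x (a + b) = f x a + f x b"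
  shows "(\<Sum>x\<in>Poly_Mapping.keys (p + q). f x (Poly_Mapping.lookup (p + q) x))
       = (\<Sum>x\<in>Poly_Mapping.keys p. f x (Poly_Mapping.lookup p x))
       + (\<Sum>x\<in>Poly_Mapping.keys q. f x (Poly_Mapping.lookup q x))"
proof -
  let ?A = "Poly_Mapping.keys p \<union> Poly_Mapping.keys q"
  have "Poly_Mapping.keys (p + q) \<subseteq> ?A"
    by (rule Poly_Mapping.keys_add)
  then have "(\<Sum>x\<in>Poly_Mapping.keys (p + q). f x (Poly_Mapping.lookup (p + q) x))
      = (\<Sum>x\<in>?A. f x (Poly_Mapping.lookup (p + q) x))"
    using assms(1) by (intro sum_keys_superset) auto
  also have "\<dots> = (\<Sum>x\<in>?A. f x (Poly_Mapping.lookup p x)) + (\<Sum>x\<in>?A. f x (Poly_Mapping.lookup q x))"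
    by (simp add: lookup_add assms(2) sum.distrib)
  also have "\<dots> = (\<Sum>x\<in>Poly_Mapping.keys p. f x (Poly_Mapping.lookup p x))
       + (\<Sum>x\<in>Poly_Mapping.keys q. f x (Poly_Mapping.lookup q x))"
    using assms(1) by (intro arg_cong2[of _ _ _ _ "(+)"] sum_keys_superset[symmetric]) auto
  finally show ?thesis .
qed

text \<open>A linear functional that replaces explicit chains of monomials: it kills a multiple of a
  binomial whenever \<open>P\<close> holds for both or neither of the two monomials of each
  term.\<close>

definition coeff_sum :: "((var \<Rightarrow>\<^sub>0 nat) \<Rightarrow> bool) \<Rightarrow> 'k::comm_ring_1 mpoly \<Rightarrow> 'k" where
  "coeff_sum P p = (\<Sum>m\<in>Poly_Mapping.keys p. if P m then Poly_Mapping.lookup p m else 0)"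

lemma coeff_sum_add: "coeff_sum P (p + q) = coeff_sum P p + coeff_sum P q"
  unfolding coeff_sum_def by (rule sum_keys_add[of "\<lambda>m x. if P m then x else 0"]) auto

lemma coeff_sum_0 [simp]: "coeff_sum P 0 = 0"
  by (simp add: coeff_sum_def)

lemma coeff_sum_uminus: "coeff_sum P (- p) = - coeff_sum P p"
  using coeff_sum_add[of P p "- p"] by (simp add: eq_neg_iff_add_eq_0 add.commute)

lemma coeff_sum_diff: "coeff_sum P (p - q) = coeff_sum P p - coeff_sum P q"
  using coeff_sum_add[of P p "- q"] by (simp add: coeff_sum_uminus)

lemma coeff_sum_sum: "coeff_sum P (\<Sum>x\<in>A. f x) = (\<Sum>x\<in>A. coeff_sum P (f x))"
  by (induction A rule: infinite_finite_induct) (auto simp: coeff_sum_add)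

lemma coeff_sum_single: "coeff_sum P (Poly_Mapping.single m x) = (if P m then x else 0)"
  by (simp add: coeff_sum_def)

lemma poly_mapping_sum_singles:
  "(\<Sum>m\<in>Poly_Mapping.keys q. Poly_Mapping.single m (Poly_Mapping.lookup q m)) = q"
  by (rule poly_mapping_eqI)
    (simp add: lookup_sum lookup_single when_def not_in_keys_iff_lookup_eq_zero)

lemma coeff_sum_mult_eq_0:
  assumes "\<And>m. m \<in> Poly_Mapping.keys q \<Longrightarrow> P (m + a) = P (m + b)"
  shows "coeff_sum P (q * (monom a - monom b)) = 0"
proof -
  have "q * (monom a - monom b) =
      (\<Sum>m\<in>Poly_Mapping.keys q. Poly_Mapping.single m (Poly_Mapping.lookup q m)) * (monom a - monom b)"
    by (simp add: poly_mapping_sum_singles)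
  also have "\<dots> = (\<Sum>m\<in>Poly_Mapping.keys q. Poly_Mapping.single (m + a) (Poly_Mapping.lookup q m)
                                 - Poly_Mapping.single (m + b) (Poly_Mapping.lookup q m))"
    by (simp add: sum_distrib_right right_diff_distrib mult_single sum_subtractf)
  finally show ?thesis
    using assms by (simp add: coeff_sum_sum coeff_sum_diff coeff_sum_single)
qed

lemma lookup_le_tdeg:
  assumes "m \<in> Poly_Mapping.keys p"
  shows "Poly_Mapping.lookup m v \<le> tdeg p"
proof -
  have "Poly_Mapping.lookup m v \<le> (\<Sum>w\<in>Poly_Mapping.keys m. Poly_Mapping.lookup m w)"
    by (cases "v \<in> Poly_Mapping.keys m") (auto simp: in_keys_iff intro: member_le_sum)
  also have "\<dots> \<le> tdeg p"
    unfolding tdeg_def using assms by (intro Max_ge) auto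
  finally show ?thesis .
qed

text \<open>
  The substitution $s_r \mapsto c_{11} \cdots c_{r-1,1}$, $f_r \mapsto c_{11} \cdots c_{r-2,1} c_{r-1,4}$,
  with an additional factor $b_{01}^d$ for $r = n$. It does not change the exponents of $b_{ji}$ for $j > 0$.
\<close>
primrec var_exp :: "nat \<Rightarrow> nat \<Rightarrow> var \<Rightarrow> var \<Rightarrow> nat" where
  "var_exp n d (S r) = start_exp (if r = n then d else 0) (r - 1)"
| "var_exp n d (F r) = finish_exp (if r = n then d else 0) (r - 1)"
| "var_exp n d (B j i) = unit_exp (B j i) 1"
| "var_exp n d (C j i) = unit_exp (C j i) 1"

definition subst_exp :: "nat \<Rightarrow> nat \<Rightarrow> (var \<Rightarrow>\<^sub>0 nat) \<Rightarrow> var \<Rightarrow> nat" where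
  "subst_exp n d m = (\<lambda>v. \<Sum>w\<in>Poly_Mapping.keys m. Poly_Mapping.lookup m w * var_exp n d w v)"

lemma subst_exp_add: "subst_exp n d (a + b) = subst_exp n d a + subst_exp n d b"
  unfolding subst_exp_def
  by (rule ext) (simp add: sum_keys_add[of "\<lambda>w x. x * var_exp n d w _"] distrib_right)

lemma subst_exp_single: "subst_exp n d (Poly_Mapping.single v k) = (\<lambda>w. k * var_exp n d v w)"
  by (auto simp: subst_exp_def)

lemma subst_exp_single_BC [simp]:
  "subst_exp n d (Poly_Mapping.single (B j i) k) = unit_exp (B j i) k"
  "subst_exp n d (Poly_Mapping.single (C j i) k) = unit_exp (C j i) k"
  by (auto simp: subst_exp_single unit_exp_def)

lemma subst_exp_single_SF [simp]:
  "subst_exp n d (Poly_Mapping.single (S r) 1) = start_exp (if r = n then d else 0) (r - 1)"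
  "subst_exp n d (Poly_Mapping.single (F r) 1) = finish_exp (if r = n then d else 0) (r - 1)"
  by (auto simp: subst_exp_single)

lemma unit_exp_0 [simp]: "unit_exp v 0 = 0"
  by (auto simp: unit_exp_def)

text \<open>With parameter 0 the power of $b_{01}$ disappears: \<open>start_exp 0 r\<close> stands
  for $s_{r+1}$ itself and \<open>start_exp d r\<close> for $b_{01}^d s_{r+1}$.\<close>

lemma start_exp_split: "unit_exp (B 0 1) d + start_exp 0 r = start_exp d r"
  by (induction r) (auto simp: fun_eq_iff)

lemma finish_exp_split: "unit_exp (B 0 1) d + finish_exp 0 (Suc r) = finish_exp d (Suc r)"
  using start_exp_split[of d r] by (auto simp: fun_eq_iff)

lemma subst_exp_B:
  assumes "0 < j"
  shows "subst_exp n d m (B j i) = Poly_Mapping.lookup m (B j i)"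
proof -
  have "var_exp n d w (B j i) = (if B j i = w then 1 else 0)" for w
    using assms by (cases w) auto
  then show ?thesis
    by (simp add: subst_exp_def if_distrib[of "(*) _"] not_in_keys_iff_lookup_eq_zero
        del: One_nat_def cong: if_cong)
qed

section \<open>The generators as moves\<close>

text \<open>Unions over explicit index sets allow treating the generators family by family, in the
  lower bound as well as in the membership.\<close>

lemma set_Kgens:
  "set (Kgens n d :: 'k::comm_ring_1 mpoly list) =
     (let s = (\<lambda>r. Var (S r)); f = (\<lambda>r. Var (F r));
          b = (\<lambda>j i. Var (B j i)); c = (\<lambda>j i. Var (C j i)) in
       {b 0 1 * b 0 3 ^ d - b 0 4 * b 0 2 ^ d}
     \<union> (\<Union>i\<in>{1,2,3,4}. {c 1 i * (b 0 2 - b 1 i * b 0 3)})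
     \<union> (\<Union>i\<in>{1,2,3,4}. {c 1 i * (b 0 1 - b 1 i ^ d * b 0 4)})
     \<union> (\<Union>i\<in>{1,2,3,4}. \<Union>j\<in>{1,2,3,4}. {g. g = c 1 i * c 1 j * (b 1 i - b 1 j) \<and> i < j})
     \<union> {b 0 4 ^ d * c 1 1 - b 0 1 ^ d * c 1 2,
        b 0 4 ^ d * c 1 4 - b 0 1 ^ d * c 1 3,
        b 0 1 ^ d * (c 1 2 - c 1 3),
        b 0 4 ^ d * (c 1 2 * b 1 1 - c 1 3 * b 1 4)}
     \<union> (\<Union>i\<in>{1,2,3,4}. {b 0 4 ^ d * c 1 2 * c 2 i * (b 1 2 - b 2 i * b 1 3)})
     \<union> {s 2 - c 1 1, f 2 - c 1 4}
     \<union> (\<Union>r\<in>{3..<n}. {s r - s (r - 1) * c (r - 1) 1, f r - s (r - 1) * c (r - 1) 4})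
     \<union> (\<Union>r\<in>{3..<n+1}.
          {b 0 1 ^ d * (f (r - 1) * c (r - 1) 1 - s (r - 1) * c (r - 1) 2),
           b 0 1 ^ d * (f (r - 1) * c (r - 1) 4 - s (r - 1) * c (r - 1) 3),
           b 0 1 ^ d * s (r - 1) * (c (r - 1) 3 - c (r - 1) 2),
           b 0 1 ^ d * f (r - 1) * (c (r - 1) 2 * b (r - 1) 1 - c (r - 1) 3 * b (r - 1) 4)})
     \<union> (\<Union>r\<in>{3..<n}. \<Union>i\<in>{1,2,3,4}.
          {b 0 1 ^ d * f (r - 1) * c (r - 1) 2 * c r i * (b (r - 1) 2 - b r i * b (r - 1) 3)})
     \<union> {s n - s (n - 1) * c (n - 1) 1 * b 0 1 ^ d,
        f n - s (n - 1) * c (n - 1) 4 * b 0 1 ^ d,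
        b 0 1 ^ d * f (n - 1) * c (n - 1) 2 * (b (n - 1) 2 - b (n - 1) 3)})"
proof -
  define A where "A = {1,2,3,4::nat}"
  have A: "{1..<5} = A" by (auto simp: A_def)
  have guard: "set (if P then [x] else []) = {y. y = x \<and> P}" for P and x :: "'k mpoly" by auto
  have concat: "set (concat (map h xs)) = (\<Union>x\<in>set xs. set (h x))" for h :: "nat \<Rightarrow> 'k mpoly list" and xs
    by auto
  have map: "set (map h xs) = (\<Union>x\<in>set xs. {h x})" for h :: "nat \<Rightarrow> 'k mpoly" and xs
    by auto
  show ?thesis
    unfolding Kgens_def Let_def A_def[symmetric] set_append concat map guard set_upt A list.set
    by (simp only: Un_assoc)
qed

definition trap_gen :: "nat \<Rightarrow> nat \<Rightarrow> 'k::comm_ring_1 mpoly \<Rightarrow> bool" where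
  "trap_gen n d g \<longleftrightarrow> (\<exists>a b. g = monom a - monom b \<and> trap_move d (n - 1) (subst_exp n d a) (subst_exp n d b))"

lemma trap_genI:
  assumes "trap_move d (n - 1) (subst_exp n d a) (subst_exp n d b)"
  shows "trap_gen n d (monom a - monom b)"
  using assms by (auto simp: trap_gen_def)

lemmas to_monom = right_diff_distrib Var_eq_monom monom_power monom_mult

lemmas subst_exp_simps = subst_exp_add subst_exp_single_BC subst_exp_single_SF

lemma trap_gen_Kgens:
  assumes "n \<ge> 3" "d \<ge> 1" "g \<in> set (Kgens n d :: 'k::comm_ring_1 mpoly list)"
  shows "trap_gen n d g"
proof -
  \<comment> \<open>Writing $r = k + 3$ makes the index differences evaluate; the inequations with
    \<open>n\<close> show that the variables concerned receive no factor $b_{01}^d$ from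
    \<open>var_exp\<close>.\<close>
  have idx: "\<exists>k. r = Suc (Suc (Suc k)) \<and> Suc k < n - 1 \<and> Suc (Suc k) \<noteq> n" if "r \<in> {3..<n+1}" for r
    using that by (intro exI[of _ "r - 3"]) auto
  have idx': "\<exists>k. r = Suc (Suc (Suc k)) \<and> Suc (Suc k) < n - 1 \<and> Suc (Suc k) \<noteq> n
      \<and> Suc (Suc (Suc k)) \<noteq> n" if "r \<in> {3..<n}" for r
    using that by (intro exI[of _ "r - 3"]) auto
  have n2: "2 \<noteq> n" "0 < n - 1" "Suc 0 < n - 1"
    using assms(1) by auto
  obtain N where n: "n = Suc (Suc (Suc N))"
    using assms(1) idx[of n] by auto
  have trap_move_eqI: "trap_move d N a b" if "a = b" for N a b
    using that by simp
  note base_moves = trap_move_1[of 0 "n - 1" d] trap_move_2[of 0 "n - 1" d] trap_move_4[of 0 "n - 1" d]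
  \<comment> \<open>The generator at level 1 is $c_{12} - c_{13}$, opposite in sign to those of the
    higher levels.\<close>
  have move_3': "r < n - 1 \<Longrightarrow> trap_move d (n - 1) (start_exp d r + unit_exp (C (Suc r) 2) 1)
                       (start_exp d r + unit_exp (C (Suc r) 3) 1)" for r
    using trap_move_3 by (auto simp: trap_move_def)
  show ?thesis
    using assms(3) unfolding set_Kgens Let_def
  proof (elim UnE, goal_cases)
    case 1
    then show ?case
      apply (elim singletonE)
      apply (simp only: to_monom)
      apply (rule trap_genI)
      apply (simp only: subst_exp_simps)
      apply (rule trap_move_B02_B03[of 3 2])
      using assms(2) by auto
  next
    case 2
    then show ?case
      apply clarify
      apply (simp only: to_monom)
      apply (rule trap_genI)
      apply (simp only: subst_exp_simps)
      apply (rule trap_move_B02_B03[of 2 3])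
      by auto
  next
    case 3
    then show ?case
      apply clarify
      apply (simp only: to_monom)
      apply (rule trap_genI)
      apply (simp only: subst_exp_simps add.assoc[symmetric])
      by (rule trap_move_base[OF n2(2)])
  next
    case 4
    then show ?case
      apply clarify
      subgoal for i j
      apply (simp only: to_monom)
      apply (rule trap_genI)
      apply (simp only: subst_exp_simps)
      apply (rule trap_move_C1_C1[of i j])
      using n2 by auto
      done
  next
    case 5
    then show ?case
      apply (elim insertE emptyE)
         apply (simp_all only: to_monom)
         apply (rule_tac [!] trap_genI)
         apply (simp_all only: subst_exp_simps add.assoc[symmetric])
      using base_moves move_3'[of 0] n2 by auto
  next
    case 6
    then show ?case
      apply clarify
      apply (simp only: to_monom)
      apply (rule trap_genI)
      apply (simp only: subst_exp_simps add.assoc[symmetric])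
      using trap_move_5[of 0 "n - 1" _ d] n2 by (simp add: numeral_2_eq_2)
  next
    \<comment> \<open>The substitution sends both monomials of a generator defining some $s_r$ or
      $f_r$ to the same exponents; likewise in case 8 and twice in case 11.\<close>
    case 7
    then show ?case
      apply (elim insertE emptyE)
       apply (simp_all only: to_monom)
       apply (rule_tac [!] trap_genI)
       apply (simp_all only: subst_exp_simps)
      using n2 by (auto simp: fun_eq_iff intro!: trap_move_eqI)
  next
    case 8
    then show ?case
      apply (elim UN_E)
      apply (drule idx', elim exE conjE insertE emptyE)
       apply (simp_all only: to_monom)
       apply (rule_tac [!] trap_genI)
       apply (simp_all only: subst_exp_simps)
      by (auto simp: fun_eq_iff intro!: trap_move_eqI)
  next
    case 9
    then show ?case
      apply (elim UN_E)
      apply (drule idx, elim exE conjE insertE emptyE)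
         apply (simp_all only: to_monom)
         apply (rule_tac [!] trap_genI)
         apply (simp_all only: subst_exp_simps add.assoc[symmetric] diff_Suc_1 if_False finish_exp_split start_exp_split)
         apply (rule trap_move_1 trap_move_2 trap_move_3 trap_move_4; assumption)+
      done
  next
    case 10
    then show ?case
      apply clarify
      apply (drule idx', elim exE conjE)
      apply (simp only: to_monom)
      apply (rule trap_genI)
      apply (simp only: subst_exp_simps add.assoc[symmetric] diff_Suc_1 if_False finish_exp_split start_exp_split)
      by (rule trap_move_5)
  next
    case 11
    then show ?case
      apply (elim insertE emptyE)
        apply (simp_all only: to_monom)
        apply (rule_tac [!] trap_genI)
        apply (simp_all only: subst_exp_simps)
      subgoal using start_exp_split[of d N, symmetric] by (auto simp: n fun_eq_iff intro!: trap_move_eqI)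
      subgoal using start_exp_split[of d N, symmetric] by (auto simp: n fun_eq_iff intro!: trap_move_eqI)
      subgoal by (rule trap_move_outside[of 2 2]) (use n2 in auto)
      done
  qed
qed

section \<open>The lower bound\<close>

lemma coeff_sum_combination_eq_0:
  assumes "length q = length gs"
    and "\<And>p g. p \<in> set q \<Longrightarrow> g \<in> set gs \<Longrightarrow> coeff_sum P (p * g) = 0"
  shows "coeff_sum P (sum_list (map2 (*) q gs)) = 0"
  using assms by (induction q gs rule: list_induct2) (auto simp: coeff_sum_add)

text \<open>If all coefficients had smaller degree, \<open>coeff_sum\<close> over the trap would
  vanish on the whole combination, but it is 1 on $s_n - f_n$.\<close>

theorem Krep_degree_lower_bound:
  fixes q :: "'k::comm_ring_1 mpoly list"
  assumes "n \<ge> 3" "d \<ge> 1" and rep: "is_Krep n d q (Var (S n) - Var (F n))"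
  shows "\<exists>p\<in>set q. d ^ 2 ^ (n - 1) \<le> tdeg p"
proof (rule ccontr)
  assume "\<not> ?thesis"
  then have small: "tdeg p < d ^ 2 ^ (n - 1)" if "p \<in> set q" for p
    using that by (auto simp: not_le)
  let ?P = "\<lambda>m. trap d (n - 1) (subst_exp n d m)"
  have "coeff_sum ?P (p * g) = 0" if p: "p \<in> set q" and g: "g \<in> set (Kgens n d)" for p g
  proof -
    obtain a b where ab: "g = monom a - monom b"
        "trap_move d (n - 1) (subst_exp n d a) (subst_exp n d b)"
      using trap_gen_Kgens[OF assms(1,2) g] by (auto simp: trap_gen_def)
    have "?P (m + a) = ?P (m + b)" if "m \<in> Poly_Mapping.keys p" for m
    proof -
      \<comment> \<open>The substitution preserves this exponent, so the degree of \<open>p\<close>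
        bounds it.\<close>
      have "subst_exp n d m (B (n - 1) 1) < d ^ 2 ^ (n - 1)"
        using lookup_le_tdeg[OF that, of "B (n - 1) 1"] small[OF p] assms(1)
        by (simp add: subst_exp_B)
      with ab(2) show ?thesis
        by (simp add: trap_move_def subst_exp_add)
    qed
    then show ?thesis
      unfolding ab(1) by (rule coeff_sum_mult_eq_0)
  qed
  then have "coeff_sum ?P (Var (S n) - Var (F n) :: 'k mpoly) = 0"
    using coeff_sum_combination_eq_0[of q "Kgens n d" ?P] rep by (auto simp: is_Krep_def)
  moreover have "?P (Poly_Mapping.single (S n) 1)"
    unfolding subst_exp_single_SF using trap_start[of "n - 1" d] assms(1) by simp
  \<comment> \<open>The image of $f_n$ contains $c_{n-1,4}$ and is thus outside the trap.\<close>
  moreover have "\<not> ?P (Poly_Mapping.single (F n) 1)"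
  proof -
    have N: "n - 1 = Suc (n - 2)" using assms(1) by simp
    have "finish_exp d (n - 1) (C (Suc (n - 2)) 4) = 1"
      unfolding N by simp
    then have "\<not> trap d (Suc (n - 2)) (finish_exp d (n - 1))"
      using trap_exactly_one(3)[of d "n - 2" "finish_exp d (n - 1)"] by auto
    then show ?thesis
      by (simp only: subst_exp_single_SF N[symmetric] refl if_True not_False_eq_True)
  qed
  ultimately show False
    unfolding Var_eq_monom by (simp only: coeff_sum_diff coeff_sum_single) simp
qed

section \<open>The degree of $s_n - f_n$ and the growth of the bound\<close>

lemma tdeg_Var_diff:
  assumes "v \<noteq> w"
  shows "tdeg (Var v - Var w :: 'k::comm_ring_1 mpoly) = 1"
proof -
  have "Poly_Mapping.single v (1::nat) \<noteq> Poly_Mapping.single w 1"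
    by (metis assms lookup_single_eq lookup_single_not_eq zero_neq_one)
  then have "Poly_Mapping.lookup (Var v - Var w :: 'k mpoly) (Poly_Mapping.single v 1) = 1"
       "Poly_Mapping.lookup (Var v - Var w :: 'k mpoly) (Poly_Mapping.single w 1) = - 1"
    by (auto simp: Var_def lookup_minus lookup_single when_def)
  then have "Poly_Mapping.keys (Var v - Var w :: 'k mpoly) \<supseteq> {Poly_Mapping.single v 1, Poly_Mapping.single w 1}"
    by (auto simp: in_keys_iff)
  moreover have "Poly_Mapping.keys (Var v - Var w :: 'k mpoly) \<subseteq> {Poly_Mapping.single v 1, Poly_Mapping.single w 1}"
    using keys_diff[of "Var v :: 'k mpoly" "Var w"] by (auto simp: Var_def)
  ultimately have "Poly_Mapping.keys (Var v - Var w :: 'k mpoly) = {Poly_Mapping.single v 1, Poly_Mapping.single w 1}"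
    by blast
  then show ?thesis
    by (simp add: tdeg_def)
qed

text \<open>The constant 1/2 comes from $n/2 <= n - 1$ for $n >= 2$.\<close>

lemma tower_le:
  assumes "n \<ge> 2" "d \<ge> 2" "d ^ 2 ^ (n - 1) \<le> D"
  shows "2 powr (2 powr (1 / 2 * real n)) \<le> real D"
proof -
  have "2 powr (1 / 2 * real n) \<le> 2 powr real (n - 1)"
    using assms(1) by (intro powr_mono) auto
  also have "\<dots> = real (2 ^ (n - 1))"
    by (simp add: powr_realpow)
  finally have "2 powr (2 powr (1 / 2 * real n)) \<le> 2 powr real (2 ^ (n - 1))"
    by (intro powr_mono) auto
  also have "\<dots> = real (2 ^ 2 ^ (n - 1))"
    by (subst powr_realpow) auto
  also have "\<dots> \<le> real (d ^ 2 ^ (n - 1))"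
    using assms(2) by (intro of_nat_mono power_mono) auto
  also have "\<dots> \<le> real D"
    using assms(3) by simp
  finally show ?thesis .
qed

section \<open>Congruence modulo an ideal\<close>

text \<open>The type of polynomials has infinitely many variables, so \<open>T\<close> records the
  subring from which coefficients may come, and congruences are multiplied only by its
  elements.\<close>

locale ideal_cong =
  fixes T I :: "'a::comm_ring_1 set"
  assumes one_T: "1 \<in> T" and uminus_T: "a \<in> T \<Longrightarrow> - a \<in> T"
    and mult_T: "a \<in> T \<Longrightarrow> b \<in> T \<Longrightarrow> a * b \<in> T"
    and zero_I: "0 \<in> I"
    and add_I: "x \<in> I \<Longrightarrow> y \<in> I \<Longrightarrow> x + y \<in> I"
    and mult_I: "a \<in> T \<Longrightarrow> x \<in> I \<Longrightarrow> a * x \<in> I"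
begin

definition cong :: "'a \<Rightarrow> 'a \<Rightarrow> bool" (infix \<open>\<approx>\<close> 50) where
  "x \<approx> y \<longleftrightarrow> x - y \<in> I"

lemma cong_refl: "x \<approx> x"
  by (simp add: cong_def zero_I)

lemma cong_sym: "x \<approx> y \<Longrightarrow> y \<approx> x"
  using mult_I[OF uminus_T[OF one_T], of "x - y"] by (simp add: cong_def)

lemma cong_trans [trans]: "x \<approx> y \<Longrightarrow> y \<approx> z \<Longrightarrow> x \<approx> z"
  using add_I[of "x - y" "y - z"] by (simp add: cong_def)

lemma cong_mult: "x \<approx> y \<Longrightarrow> a \<in> T \<Longrightarrow> a * x \<approx> a * y"
  using mult_I[of a "x - y"] by (simp add: cong_def right_diff_distrib)

lemma cong_multI: "x \<approx> y \<Longrightarrow> a \<in> T \<Longrightarrow> x' = a * x \<Longrightarrow> y' = a * y \<Longrightarrow> x' \<approx> y'"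
  using cong_mult by simp

lemma power_T: "a \<in> T \<Longrightarrow> a ^ k \<in> T"
  by (induction k) (auto simp: one_T mult_T)

text \<open>The factor \<open>w\<close> acts as a catalyst: it survives each exchange and is
  available for the next.\<close>

lemma cong_power_exchange:
  assumes "w * x \<approx> w * y" "x \<in> T" "y \<in> T"
  shows "w * x ^ k \<approx> w * y ^ k"
proof (induction k)
  case 0
  then show ?case by (simp add: cong_refl)
next
  case (Suc k)
  have "w * x ^ Suc k \<approx> w * x * y ^ k"
    by (rule cong_multI[OF Suc, of x]) (simp_all add: assms mult_ac)
  also have "\<dots> \<approx> w * y ^ Suc k"
    by (rule cong_multI[OF assms(1), of "y ^ k"]) (simp_all add: assms power_T mult_ac)
  finally show ?case .
qed

text \<open>The passage from one level to the next, applied with $w = c_{r+1,i}$ and $v =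
  b_{r+1,i}$, and with $w = v = 1$ at the top.\<close>

lemma level_step:
  assumes T: "c4 \<in> T" "b1 \<in> T" "b2 \<in> T" "b3 \<in> T" "b4 \<in> T" "w \<in> T" "v \<in> T"
    and c1: "s * c1 \<approx> f * c1 * b1 ^ e" and c2: "s * c2 \<approx> f * c2 * b2 ^ e"
    and c3: "s * c3 \<approx> f * c3 * b3 ^ e" and c4: "s * c4 \<approx> f * c4 * b4 ^ e"
    and m1: "f * c1 \<approx> s * c2" and m2: "f * c4 \<approx> s * c3" and m3: "s * c3 \<approx> s * c2"
    and m4: "f * (c2 * b1) \<approx> f * (c3 * b4)"
    and m5: "f * c2 * w * b2 \<approx> f * c2 * w * (v * b3)"
  shows "s * c1 * w \<approx> s * c4 * w * v ^ (e * e)"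
proof -
  note T' = T mult_T power_T
  \<comment> \<open>One pass: \<open>s\<close> unfolds to \<open>f\<close> and $b_2^e$, all $b_2$
    become $v b_3$, one $b_1$ becomes $b_4$ in passing to state $c_3$, and $b_3^e$ folds back to
    \<open>s\<close>, leaving $v^e$.\<close>
  have loop: "s * c2 * w * b1 \<approx> s * c2 * w * (b4 * v ^ e)"
  proof -
    have "s * c2 * w * b1 \<approx> f * c2 * w * b2 ^ e * b1"
      by (rule cong_multI[OF c2, of "w * b1"]) (simp_all add: T' mult_ac)
    also have "\<dots> \<approx> f * c2 * w * (v * b3) ^ e * b1"
      by (rule cong_multI[OF cong_power_exchange[OF m5, of e], of b1]) (simp_all add: T' mult_ac)
    also have "\<dots> \<approx> f * (c3 * b4) * w * (v * b3) ^ e"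
      by (rule cong_multI[OF m4, of "w * (v * b3) ^ e"]) (simp_all add: T' mult_ac)
    also have "\<dots> \<approx> s * c3 * b4 * w * v ^ e"
      by (rule cong_multI[OF cong_sym[OF c3], of "b4 * w * v ^ e"])
        (simp_all add: T' mult_ac power_mult_distrib)
    also have "\<dots> \<approx> s * c2 * w * (b4 * v ^ e)"
      by (rule cong_multI[OF m3, of "b4 * w * v ^ e"]) (simp_all add: T' mult_ac)
    finally show ?thesis .
  qed
  \<comment> \<open>Unfolding at $c_1$ supplies $b_1^e$, hence \<open>e\<close> passes; the
    resulting $b_4^e$ is absorbed on folding back at $c_4$.\<close>
  have "s * c1 * w \<approx> f * c1 * b1 ^ e * w"
    by (rule cong_multI[OF c1, of w]) (simp_all add: T' mult_ac)
  also have "\<dots> \<approx> s * c2 * w * b1 ^ e"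
    by (rule cong_multI[OF m1, of "w * b1 ^ e"]) (simp_all add: T' mult_ac)
  also have "\<dots> \<approx> s * c2 * w * (b4 * v ^ e) ^ e"
    by (rule cong_power_exchange[OF loop]) (simp_all add: T')
  also have "\<dots> \<approx> s * c3 * w * (b4 * v ^ e) ^ e"
    by (rule cong_multI[OF cong_sym[OF m3], of "w * (b4 * v ^ e) ^ e"]) (simp_all add: T' mult_ac)
  also have "\<dots> \<approx> f * c4 * w * (b4 * v ^ e) ^ e"
    by (rule cong_multI[OF cong_sym[OF m2], of "w * (b4 * v ^ e) ^ e"]) (simp_all add: T' mult_ac)
  also have "\<dots> \<approx> s * c4 * w * v ^ (e * e)"
    by (rule cong_multI[OF cong_sym[OF c4], of "w * v ^ (e * e)"])
      (simp_all add: T' mult_ac power_mult_distrib power_mult)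
  finally show ?thesis .
qed

end

section \<open>Linear combinations of a list of generators\<close>

definition combinations :: "'a::comm_ring_1 set \<Rightarrow> 'a list \<Rightarrow> 'a set" where
  "combinations T gs = {sum_list (map2 (*) q gs) | q. length q = length gs \<and> set q \<subseteq> T}"

lemma combinations_Nil: "combinations T [] = {0}"
  by (auto simp: combinations_def)

lemma combinations_Cons: "combinations T (g # gs) = {a * g + x | a x. a \<in> T \<and> x \<in> combinations T gs}"
proof (intro equalityI subsetI)
  fix y assume "y \<in> combinations T (g # gs)"
  then obtain q where "y = sum_list (map2 (*) q (g # gs))" "length q = Suc (length gs)" "set q \<subseteq> T"
    by (auto simp: combinations_def)
  then show "y \<in> {a * g + x | a x. a \<in> T \<and> x \<in> combinations T gs}"
    by (cases q) (auto simp: combinations_def)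
next
  fix y assume "y \<in> {a * g + x | a x. a \<in> T \<and> x \<in> combinations T gs}"
  then obtain a q where "y = a * g + sum_list (map2 (*) q gs)" "length q = length gs" "set q \<subseteq> T" "a \<in> T"
    by (auto simp: combinations_def)
  then show "y \<in> combinations T (g # gs)"
    unfolding combinations_def by (intro CollectI exI[of _ "a # q"]) auto
qed

locale subring =
  fixes T :: "'a::comm_ring_1 set"
  assumes one: "1 \<in> T" and uminus: "a \<in> T \<Longrightarrow> - a \<in> T"
    and add: "a \<in> T \<Longrightarrow> b \<in> T \<Longrightarrow> a + b \<in> T"
    and mult: "a \<in> T \<Longrightarrow> b \<in> T \<Longrightarrow> a * b \<in> T"
begin

lemma zero: "0 \<in> T"
  using add[OF one uminus[OF one]] by simp

lemma zero_combinations: "0 \<in> combinations T gs"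
proof (induction gs)
  case Nil
  then show ?case by (simp add: combinations_Nil)
next
  case (Cons g gs)
  then show ?case
    unfolding combinations_Cons by (intro CollectI exI[of _ 0] exI[of _ 0]) (auto simp: zero)
qed

lemma add_combinations:
  "x \<in> combinations T gs \<Longrightarrow> y \<in> combinations T gs \<Longrightarrow> x + y \<in> combinations T gs"
proof (induction gs arbitrary: x y)
  case Nil
  then show ?case by (simp add: combinations_Nil)
next
  case (Cons g gs)
  then obtain a x' b y' where "x = a * g + x'" "y = b * g + y'" "a \<in> T" "b \<in> T"
      "x' \<in> combinations T gs" "y' \<in> combinations T gs"
    unfolding combinations_Cons by blast
  with Cons.IH show ?case
    unfolding combinations_Cons
    by (intro CollectI exI[of _ "a + b"] exI[of _ "x' + y'"]) (auto simp: add algebra_simps)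
qed

lemma mult_combinations:
  "c \<in> T \<Longrightarrow> x \<in> combinations T gs \<Longrightarrow> c * x \<in> combinations T gs"
proof (induction gs arbitrary: x)
  case Nil
  then show ?case by (simp add: combinations_Nil)
next
  case (Cons g gs)
  then obtain a x' where "x = a * g + x'" "a \<in> T" "x' \<in> combinations T gs"
    unfolding combinations_Cons by blast
  with Cons.IH[of x'] \<open>c \<in> T\<close> show ?case
    unfolding combinations_Cons
    by (intro CollectI exI[of _ "c * a"] exI[of _ "c * x'"]) (auto simp: mult distrib_left mult.assoc)
qed

lemma generator_combinations: "g \<in> set gs \<Longrightarrow> g \<in> combinations T gs"
proof (induction gs)
  case Nil
  then show ?case by simp
next
  case (Cons h gs)
  show ?case
  proof (cases "g = h")
    case True
    then show ?thesis
      unfolding combinations_Cons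
      by (intro CollectI exI[of _ 1] exI[of _ 0]) (auto simp: one zero_combinations)
  next
    case False
    with Cons show ?thesis
      unfolding combinations_Cons by (intro CollectI exI[of _ 0] exI[of _ g]) (auto simp: zero)
  qed
qed

sublocale ideal_cong T "combinations T gs" for gs
  by unfold_locales
    (auto intro: one uminus mult zero_combinations add_combinations mult_combinations)

end

lemma in_K_iff: "in_K n d p \<longleftrightarrow> p \<in> combinations (Rn n) (Kgens n d)"
  by (auto simp: in_K_def is_Krep_def combinations_def)

lemma subring_Rn: "subring (Rn n :: 'k::comm_ring_1 mpoly set)"
proof
  show "1 \<in> (Rn n :: 'k mpoly set)"
    by (simp add: Rn_def)
next
  fix a :: "'k mpoly" assume "a \<in> Rn n"
  then show "- a \<in> Rn n" by (simp add: Rn_def)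
next
  fix a b :: "'k mpoly" assume "a \<in> Rn n" "b \<in> Rn n"
  then show "a + b \<in> Rn n"
    using Poly_Mapping.keys_add[of a b] by (fastforce simp: Rn_def)
next
  fix a b :: "'k mpoly" assume ab: "a \<in> Rn n" "b \<in> Rn n"
  show "a * b \<in> Rn n"
    unfolding Rn_def
  proof (intro CollectI ballI)
    fix m assume "m \<in> Poly_Mapping.keys (a * b)"
    then obtain x y where xy: "m = x + y" "x \<in> Poly_Mapping.keys a" "y \<in> Poly_Mapping.keys b"
      using keys_mult[of a b] by auto
    have "Poly_Mapping.keys m \<subseteq> Poly_Mapping.keys x \<union> Poly_Mapping.keys y"
      unfolding xy(1) by (rule Poly_Mapping.keys_add)
    then show "Poly_Mapping.keys m \<subseteq> varsR n"
      using ab xy by (auto simp: Rn_def)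
  qed
qed

lemma Var_in_Rn: "v \<in> varsR n \<Longrightarrow> (Var v :: 'k::comm_ring_1 mpoly) \<in> Rn n"
  by (auto simp: Var_def Rn_def)

section \<open>The membership\<close>

context
  fixes n d :: nat and s f :: "nat \<Rightarrow> 'k::comm_ring_1 mpoly" and b c :: "nat \<Rightarrow> nat \<Rightarrow> 'k mpoly"
  defines "s \<equiv> \<lambda>r. Var (S r)" and "f \<equiv> \<lambda>r. Var (F r)"
    and "b \<equiv> \<lambda>j i. Var (B j i)" and "c \<equiv> \<lambda>j i. Var (C j i)"
begin

lemmas Kgens_supset = equalityD2[OF set_Kgens[of n d, where 'k = 'k, folded s_def f_def b_def c_def],
  unfolded Let_def Un_subset_iff UN_subset_iff insert_subset ball_conj_distrib]

lemma Kgens_level_1: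
  "i \<in> {1,2,3,4} \<Longrightarrow> c 1 i * (b 0 1 - b 1 i ^ d * b 0 4) \<in> set (Kgens n d)"
  "b 0 4 ^ d * c 1 1 - b 0 1 ^ d * c 1 2 \<in> set (Kgens n d)"
  "b 0 4 ^ d * c 1 4 - b 0 1 ^ d * c 1 3 \<in> set (Kgens n d)"
  "b 0 1 ^ d * (c 1 2 - c 1 3) \<in> set (Kgens n d)"
  "b 0 4 ^ d * (c 1 2 * b 1 1 - c 1 3 * b 1 4) \<in> set (Kgens n d)"
  "i \<in> {1,2,3,4} \<Longrightarrow> b 0 4 ^ d * c 1 2 * c 2 i * (b 1 2 - b 2 i * b 1 3) \<in> set (Kgens n d)"
  "s 2 - c 1 1 \<in> set (Kgens n d)"
  "f 2 - c 1 4 \<in> set (Kgens n d)"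
  using Kgens_supset by metis+

lemma Kgens_level:
  assumes "2 \<le> r" "r < n"
  shows "b 0 1 ^ d * (f r * c r 1 - s r * c r 2) \<in> set (Kgens n d)"
    "b 0 1 ^ d * (f r * c r 4 - s r * c r 3) \<in> set (Kgens n d)"
    "b 0 1 ^ d * s r * (c r 3 - c r 2) \<in> set (Kgens n d)"
    "b 0 1 ^ d * f r * (c r 2 * b r 1 - c r 3 * b r 4) \<in> set (Kgens n d)"
proof -
  \<comment> \<open>The relations of level \<open>r\<close> are the generators with index $r +
    1$.\<close>
  have "Suc r \<in> {3..<n + 1}" using assms by simp
  then show "b 0 1 ^ d * (f r * c r 1 - s r * c r 2) \<in> set (Kgens n d)"
    "b 0 1 ^ d * (f r * c r 4 - s r * c r 3) \<in> set (Kgens n d)"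
    "b 0 1 ^ d * s r * (c r 3 - c r 2) \<in> set (Kgens n d)"
    "b 0 1 ^ d * f r * (c r 2 * b r 1 - c r 3 * b r 4) \<in> set (Kgens n d)"
    using Kgens_supset by (metis diff_Suc_1)+
qed

lemma Kgens_next_level:
  assumes "2 \<le> r" "Suc r < n"
  shows "s (Suc r) - s r * c r 1 \<in> set (Kgens n d)"
    "f (Suc r) - s r * c r 4 \<in> set (Kgens n d)"
    "i \<in> {1,2,3,4} \<Longrightarrow>
       b 0 1 ^ d * f r * c r 2 * c (Suc r) i * (b r 2 - b (Suc r) i * b r 3) \<in> set (Kgens n d)"
proof -
  have *: "Suc r \<in> {3..<n}" using assms by simp
  then show "s (Suc r) - s r * c r 1 \<in> set (Kgens n d)"
    "f (Suc r) - s r * c r 4 \<in> set (Kgens n d)"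
    using Kgens_supset by (metis diff_Suc_1)+
  have "\<forall>r\<in>{3..<n}. \<forall>i\<in>{1,2,3,4}.
      b 0 1 ^ d * f (r - 1) * c (r - 1) 2 * c r i * (b (r - 1) 2 - b r i * b (r - 1) 3) \<in> set (Kgens n d)"
    using Kgens_supset by (elim conjE) assumption
  from bspec[OF bspec[OF this *]]
  show "b 0 1 ^ d * f r * c r 2 * c (Suc r) i * (b r 2 - b (Suc r) i * b r 3) \<in> set (Kgens n d)"
    if "i \<in> {1,2,3,4}"
    using that by (simp only: diff_Suc_1)
qed

lemma Kgens_top:
  "s n - s (n - 1) * c (n - 1) 1 * b 0 1 ^ d \<in> set (Kgens n d)"
  "f n - s (n - 1) * c (n - 1) 4 * b 0 1 ^ d \<in> set (Kgens n d)"
  "b 0 1 ^ d * f (n - 1) * c (n - 1) 2 * (b (n - 1) 2 - b (n - 1) 3) \<in> set (Kgens n d)"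
  using Kgens_supset by blast+

interpretation Rn: subring "Rn n :: 'k mpoly set"
  by (rule subring_Rn)

abbreviation eqK (infix \<open>\<approx>\<close> 50) where
  "eqK \<equiv> Rn.cong (Kgens n d :: 'k mpoly list)"

text \<open>These are the $S_r$, $F_r$ of the overview; they let level 1 be treated like the
  others.\<close>

definition s' :: "nat \<Rightarrow> 'k mpoly" where
  "s' r = (if r = 1 then b 0 1 ^ d else b 0 1 ^ d * s r)"

definition f' :: "nat \<Rightarrow> 'k mpoly" where
  "f' r = (if r = 1 then b 0 4 ^ d else b 0 1 ^ d * f r)"

lemma eqK_generator: "x - y = g \<Longrightarrow> g \<in> set (Kgens n d) \<Longrightarrow> x \<approx> y"
  by (simp add: Rn.cong_def Rn.generator_combinations)

lemma b_in_Rn: "j < n \<Longrightarrow> i \<in> {1,2,3,4} \<Longrightarrow> b j i \<in> Rn n"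
  unfolding b_def by (intro Var_in_Rn) (auto simp: varsR_def)

lemma c_in_Rn: "0 < j \<Longrightarrow> j < n \<Longrightarrow> i \<in> {1,2,3,4} \<Longrightarrow> c j i \<in> Rn n"
  unfolding c_def by (intro Var_in_Rn) (auto simp: varsR_def)

lemma level_moves:
  assumes "0 < r" "r < n"
  shows "f' r * c r 1 \<approx> s' r * c r 2" "f' r * c r 4 \<approx> s' r * c r 3"
    "s' r * c r 3 \<approx> s' r * c r 2" "f' r * (c r 2 * b r 1) \<approx> f' r * (c r 3 * b r 4)"
proof -
  note alg = s'_def f'_def right_diff_distrib mult.assoc
  consider "r = 1" | "2 \<le> r" using assms by linarith
  then have "f' r * c r 1 \<approx> s' r * c r 2 \<and> f' r * c r 4 \<approx> s' r * c r 3 \<and>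
    s' r * c r 3 \<approx> s' r * c r 2 \<and> f' r * (c r 2 * b r 1) \<approx> f' r * (c r 3 * b r 4)"
  proof cases
    case 1
    have "f' r * c r 1 \<approx> s' r * c r 2"
      by (rule eqK_generator[OF _ Kgens_level_1(2)]) (simp add: 1 alg)
    moreover have "f' r * c r 4 \<approx> s' r * c r 3"
      by (rule eqK_generator[OF _ Kgens_level_1(3)]) (simp add: 1 alg)
    moreover have "s' r * c r 2 \<approx> s' r * c r 3"
      by (rule eqK_generator[OF _ Kgens_level_1(4)]) (simp add: 1 alg)
    moreover have "f' r * (c r 2 * b r 1) \<approx> f' r * (c r 3 * b r 4)"
      by (rule eqK_generator[OF _ Kgens_level_1(5)]) (simp add: 1 alg)
    ultimately show ?thesis by (blast intro: Rn.cong_sym)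
  next
    case 2
    note gens = Kgens_level[OF 2 \<open>r < n\<close>]
    from 2 have "f' r * c r 1 \<approx> s' r * c r 2"
      by (intro eqK_generator[OF _ gens(1)]) (simp add: alg)
    moreover from 2 have "f' r * c r 4 \<approx> s' r * c r 3"
      by (intro eqK_generator[OF _ gens(2)]) (simp add: alg)
    moreover from 2 have "s' r * c r 3 \<approx> s' r * c r 2"
      by (intro eqK_generator[OF _ gens(3)]) (simp add: alg)
    moreover from 2 have "f' r * (c r 2 * b r 1) \<approx> f' r * (c r 3 * b r 4)"
      by (intro eqK_generator[OF _ gens(4)]) (simp add: alg)
    ultimately show ?thesis by blast
  qed
  then show "f' r * c r 1 \<approx> s' r * c r 2" "f' r * c r 4 \<approx> s' r * c r 3"
    "s' r * c r 3 \<approx> s' r * c r 2" "f' r * (c r 2 * b r 1) \<approx> f' r * (c r 3 * b r 4)"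
    by blast+
qed

lemma next_level:
  assumes "0 < r" "Suc r < n"
  shows "s' (Suc r) \<approx> s' r * c r 1" "f' (Suc r) \<approx> s' r * c r 4"
    "i \<in> {1,2,3,4} \<Longrightarrow> f' r * c r 2 * c (Suc r) i * b r 2 \<approx> f' r * c r 2 * c (Suc r) i * (b (Suc r) i * b r 3)"
proof -
  have T: "b 0 1 ^ d \<in> Rn n"
    using assms by (intro Rn.power_T b_in_Rn) auto
  have "s' (Suc r) \<approx> s' r * c r 1 \<and> f' (Suc r) \<approx> s' r * c r 4 \<and>
    (i \<in> {1,2,3,4} \<longrightarrow> f' r * c r 2 * c (Suc r) i * b r 2 \<approx> f' r * c r 2 * c (Suc r) i * (b (Suc r) i * b r 3))"
  proof (cases "r = 1")
    case True
    have "s 2 \<approx> c 1 1" "f 2 \<approx> c 1 4"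
      by (rule eqK_generator[OF refl], rule Kgens_level_1)+
    moreover have "f' r * c r 2 * c (Suc r) i * b r 2 \<approx> f' r * c r 2 * c (Suc r) i * (b (Suc r) i * b r 3)"
      if "i \<in> {1,2,3,4}"
      by (rule eqK_generator[OF _ Kgens_level_1(6)[OF that]])
        (simp add: True f'_def numeral_2_eq_2 right_diff_distrib)
    ultimately show ?thesis
      using True T by (auto simp: s'_def f'_def numeral_2_eq_2 intro: Rn.cong_mult)
  next
    case False
    with assms have r: "2 \<le> r" by simp
    note gens = Kgens_next_level[OF r \<open>Suc r < n\<close>]
    have "s (Suc r) \<approx> s r * c r 1" "f (Suc r) \<approx> s r * c r 4"
      by (rule eqK_generator[OF refl], rule gens)+
    moreover have "f' r * c r 2 * c (Suc r) i * b r 2 \<approx> f' r * c r 2 * c (Suc r) i * (b (Suc r) i * b r 3)"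
      if "i \<in> {1,2,3,4}"
      by (rule eqK_generator[OF _ gens(3)[OF that]])
        (use r in \<open>simp add: f'_def right_diff_distrib mult.assoc\<close>)
    ultimately show ?thesis
      using r T by (auto simp: s'_def f'_def mult.assoc intro: Rn.cong_mult)
  qed
  then show "s' (Suc r) \<approx> s' r * c r 1" "f' (Suc r) \<approx> s' r * c r 4"
    "i \<in> {1,2,3,4} \<Longrightarrow> f' r * c r 2 * c (Suc r) i * b r 2 \<approx> f' r * c r 2 * c (Suc r) i * (b (Suc r) i * b r 3)"
    by blast+
qed

text \<open>At level 1 the exchange of $b_{01}$ for $b_{1i}^d b_{04}$ is made \<open>d\<close>
  times, so $e_1 = d^2$. Then \<open>level_step\<close> together with $S_{r+1} = S_r c_{r1}$ and
  $F_{r+1} = S_r c_{r4}$ modulo the ideal squares the exponent.\<close>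

lemma level_exchange:
  assumes "0 < r" "r < n" "i \<in> {1,2,3,4}"
  shows "s' r * c r i \<approx> f' r * c r i * b r i ^ (d ^ 2 ^ r)"
  using assms
proof (induction r arbitrary: i rule: nat_induct_non_zero)
  case 1
  have "c 1 i * b 0 1 \<approx> c 1 i * (b 1 i ^ d * b 0 4)"
    by (rule eqK_generator[OF _ Kgens_level_1(1)[OF 1(2)]]) (simp add: right_diff_distrib)
  then have "c 1 i * b 0 1 ^ d \<approx> c 1 i * (b 1 i ^ d * b 0 4) ^ d"
    using 1 by (intro Rn.cong_power_exchange Rn.mult Rn.power_T b_in_Rn) auto
  moreover have "c 1 i * (b 1 i ^ d * b 0 4) ^ d = f' 1 * c 1 i * b 1 i ^ (d ^ 2 ^ 1)"
    by (simp add: f'_def power_mult_distrib mult_ac power_mult[symmetric] power2_eq_square)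
  ultimately show ?case
    by (simp add: s'_def mult.commute)
next
  case (Suc r)
  let ?e = "d ^ 2 ^ r"
  have r: "r < n" using Suc.prems by simp
  note IH = Suc.IH[OF r]
  have T: "c (Suc r) i \<in> Rn n" "b (Suc r) i \<in> Rn n"
    using Suc.prems by (auto intro!: c_in_Rn b_in_Rn)
  have "s' r * c r 1 * c (Suc r) i \<approx> s' r * c r 4 * c (Suc r) i * b (Suc r) i ^ (?e * ?e)"
    by (rule Rn.level_step[OF c_in_Rn b_in_Rn b_in_Rn b_in_Rn b_in_Rn T IH IH IH IH level_moves next_level(3)])
      (use Suc.hyps Suc.prems in simp_all)
  moreover have "s' (Suc r) * c (Suc r) i \<approx> s' r * c r 1 * c (Suc r) i"
    using Rn.cong_mult[OF next_level(1)[OF Suc.hyps Suc.prems(1)] T(1)] by (simp add: mult_ac)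
  moreover have "s' r * c r 4 * c (Suc r) i * b (Suc r) i ^ (?e * ?e)
      \<approx> f' (Suc r) * c (Suc r) i * b (Suc r) i ^ (?e * ?e)"
    by (rule Rn.cong_multI[OF Rn.cong_sym[OF next_level(2)[OF Suc.hyps Suc.prems(1)]],
          of "c (Suc r) i * b (Suc r) i ^ (?e * ?e)"])
      (use T in \<open>auto simp: mult_ac intro: Rn.mult Rn.power_T\<close>)
  ultimately have "s' (Suc r) * c (Suc r) i \<approx> f' (Suc r) * c (Suc r) i * b (Suc r) i ^ (?e * ?e)"
    by (blast intro: Rn.cong_trans)
  moreover have "?e * ?e = d ^ 2 ^ Suc r"
    by (simp add: mult_2 power_add)
  ultimately show ?case
    by (simp only:)
qed

lemma start_eq_finish:
  assumes "n \<ge> 3"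
  shows "s n \<approx> f n"
proof -
  let ?r = "n - 1"
  let ?e = "d ^ 2 ^ ?r"
  have r: "0 < ?r" "?r < n" "?r \<noteq> 1" using assms by auto
  \<comment> \<open>At the top the exchange of $b_2$ for $b_3$ leaves no trace, so
    \<open>level_step\<close> is used with $w = v = 1$.\<close>
  have top: "f' ?r * c ?r 2 * 1 * b ?r 2 \<approx> f' ?r * c ?r 2 * 1 * (1 * b ?r 3)"
    by (rule eqK_generator[OF _ Kgens_top(3)]) (use r in \<open>simp add: f'_def right_diff_distrib mult.assoc\<close>)
  have "s' ?r * c ?r 1 * 1 \<approx> s' ?r * c ?r 4 * 1 * 1 ^ (?e * ?e)"
    by (rule Rn.level_step[OF c_in_Rn b_in_Rn b_in_Rn b_in_Rn b_in_Rn Rn.one Rn.one level_exchange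
          level_exchange level_exchange level_exchange level_moves top])
      (use r in simp_all)
  then have "s' ?r * c ?r 1 \<approx> s' ?r * c ?r 4"
    by simp
  moreover have "s n \<approx> s' ?r * c ?r 1"
    by (rule eqK_generator[OF _ Kgens_top(1)]) (use r in \<open>simp add: s'_def mult_ac\<close>)
  moreover have "f n \<approx> s' ?r * c ?r 4"
    by (rule eqK_generator[OF _ Kgens_top(2)]) (use r in \<open>simp add: s'_def mult_ac\<close>)
  ultimately show ?thesis
    by (blast intro: Rn.cong_sym Rn.cong_trans)
qed

lemma Var_diff_in_K:
  assumes "n \<ge> 3"
  shows "in_K n d (Var (S n) - Var (F n) :: 'k mpoly)"
  using start_eq_finish[OF assms] by (simp add: in_K_iff Rn.cong_def s_def f_def)

end

theorem theorem1p1: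
  fixes d :: nat
  assumes "d \<ge> 2"
  shows "(\<forall>n\<ge>3. in_K n d (Var (S n) - Var (F n) :: 'k::field mpoly)
                 \<and> tdeg (Var (S n) - Var (F n) :: 'k mpoly) = 1)
       \<and> (\<exists>c>0. \<exists>N. \<forall>n\<ge>N. \<forall>q. is_Krep n d q (Var (S n) - Var (F n) :: 'k mpoly)
               \<longrightarrow> (\<exists>p\<in>set q. real (tdeg p) \<ge> 2 powr (2 powr (c * real n))))"
proof (intro conjI allI impI)
  fix n :: nat assume "n \<ge> 3"
  then show "in_K n d (Var (S n) - Var (F n) :: 'k mpoly)"
    by (rule Var_diff_in_K)
  show "tdeg (Var (S n) - Var (F n) :: 'k mpoly) = 1"
    by (rule tdeg_Var_diff) simp
next
  have "\<exists>p\<in>set q. real (tdeg p) \<ge> 2 powr (2 powr (1 / 2 * real n))"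
    if n: "n \<ge> 3" and rep: "is_Krep n d q (Var (S n) - Var (F n) :: 'k mpoly)" for n q
  proof -
    obtain p where "p \<in> set q" "d ^ 2 ^ (n - 1) \<le> tdeg p"
      using Krep_degree_lower_bound[OF n _ rep] assms by auto
    moreover from this have "real (tdeg p) \<ge> 2 powr (2 powr (1 / 2 * real n))"
      using n assms by (intro tower_le) auto
    ultimately show ?thesis by blast
  qed
  then show "\<exists>c>0. \<exists>N. \<forall>n\<ge>N. \<forall>q. is_Krep n d q (Var (S n) - Var (F n) :: 'k mpoly)
               \<longrightarrow> (\<exists>p\<in>set q. real (tdeg p) \<ge> 2 powr (2 powr (c * real n)))"
    by (intro exI[of _ "1 / 2"] exI[of _ 3] conjI) auto
qed

end
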